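(* For every integer $n>0$, $$\sum_{k=0}^{n-1}q^{k}C_k^q\equiv\begin{cases} q^{\lfloor n/3\rfloor} & \text{if } n\equiv 0,1 \pmod 3,\\[4pt] -1-q^{(2n-1)/3} & \text{if } n\equiv 2 \pmod 3,\end{cases}\pmod{\Phi_n(q)},$$ as a congruence in $\mathbb{Z}[q]$.
   Context: The Gaussian $q$-binomial coefficient $\binom{n}{k}_q$ is the polynomial in $q$ given by $\binom{n}{k}_q=\dfrac{(q;q)_n}{(q;q)_k(q;q)_{n-k}}$ if $0\le k\le n$ and $\binom{n}{k}_q=0$ otherwise, where $(z;q)_n=\prod_{j=0}^{n-1}(1-zq^j)$. The $q$-Catalan number is the polynomial $C_n^q=\dfrac{1}{[n+1]_q}\binom{2n}{n}_q=\binom{2n}{n}_q-q\binom{2n}{n+1}_q$, where $[n+1]_q=\dfrac{1-q^{n+1}}{1-q}$. $\Phi_n(q)=\prod_{0\le m<n,\ \gcd(m,n)=1}(q-e^{2\pi m i/n})$ is the $n$-th cyclotomic polynomial. *)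

theory Defs
  imports Complex_Main "HOL-Computational_Algebra.Computational_Algebra"
begin

abbreviation qvar :: "int poly" where
  "qvar \<equiv> [:0, 1:]"

definition qpoch :: "'a::comm_ring_1 \<Rightarrow> 'a \<Rightarrow> nat \<Rightarrow> 'a" where
  "qpoch z q n = (\<Prod>j<n. 1 - z * q ^ j)"

text \<open>
  The operation \<open>div\<close> on integer polynomials is only meaningful when the division is exact.
  That the divisions below are exact is shown by the lemmas \<open>qbinomial_mult\<close>, \<open>qbracket_mult\<close>
  and \<open>qcatalan_mult\<close>.
\<close>

definition qbinomial :: "nat \<Rightarrow> nat \<Rightarrow> int poly" where
  "qbinomial n k =
     (if k \<le> n then qpoch qvar qvar n div (qpoch qvar qvar k * qpoch qvar qvar (n - k)) else 0)"

definition qbracket :: "nat \<Rightarrow> int poly" where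
  "qbracket n = (1 - qvar ^ n) div (1 - qvar)"

definition qcatalan :: "nat \<Rightarrow> int poly" where
  "qcatalan n = qbinomial (2 * n) n div qbracket (n + 1)"

lemma qpoch_0 [simp]: "qpoch z q 0 = 1"
  by (simp add: qpoch_def)

lemma qpoch_Suc: "qpoch q q (Suc n) = qpoch q q n * (1 - q ^ Suc n)"
  by (simp add: qpoch_def)

lemma one_minus_qvar_power_nonzero: "n > 0 \<Longrightarrow> 1 - qvar ^ n \<noteq> 0"
proof
  assume "n > 0" "1 - qvar ^ n = 0"
  from this(2) have "poly (1 - qvar ^ n) 0 = 0" by simp
  with \<open>n > 0\<close> show False by (simp add: poly_power power_0_left)
qed

lemma qpoch_qvar_nonzero: "qpoch qvar qvar n \<noteq> 0"
proof (induction n)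
  case (Suc n)
  then show ?case
    using one_minus_qvar_power_nonzero[of "Suc n"] unfolding qpoch_Suc
    by (metis mult_eq_0_iff zero_less_Suc)
qed simp

lemma qpoch_mult_qpoch_dvd:
  fixes q :: "'a::comm_ring_1"
  shows "k \<le> n \<Longrightarrow> qpoch q q k * qpoch q q (n - k) dvd qpoch q q n"
proof (induction n arbitrary: k)
  case (Suc n)
  show ?case
  proof (cases "k = 0 \<or> k = Suc n")
    case False
    then obtain l where k: "k = Suc l" and l: "l < n" 
      using Suc.prems by (cases k) auto
    define m where "m = n - k"
    have m: "n - l = Suc m" "Suc n - k = Suc m" "n = k + m"
      using k l by (auto simp: m_def)
    have "qpoch q q l * qpoch q q (Suc m) dvd qpoch q q n"
      using Suc.IH[of l] l m by simp
    hence 1: "qpoch q q l * qpoch q q (Suc m) * (1 - q ^ k) dvd qpoch q q n * (1 - q ^ k)"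
      by (rule mult_dvd_mono) simp
    have "qpoch q q k * qpoch q q m dvd qpoch q q n"
      using Suc.IH[of k] k l by (simp add: m_def)
    hence 2: "qpoch q q k * qpoch q q m * (1 - q ^ Suc m)
                dvd qpoch q q n * (q ^ k * (1 - q ^ Suc m))"
      by (rule mult_dvd_mono) simp
    have "qpoch q q (Suc n) = qpoch q q n * (1 - q ^ k) + qpoch q q n * (q ^ k * (1 - q ^ Suc m))"
      unfolding qpoch_Suc using m(3) by (simp add: algebra_simps power_add)
    moreover have "qpoch q q l * qpoch q q (Suc m) * (1 - q ^ k) = qpoch q q k * qpoch q q (Suc m)"
      unfolding k qpoch_Suc[of q l] by (simp only: mult_ac)
    moreover have "qpoch q q k * qpoch q q m * (1 - q ^ Suc m) = qpoch q q k * qpoch q q (Suc m)"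
      unfolding qpoch_Suc[of q m] by (simp only: mult_ac)
    ultimately show ?thesis
      using 1 2 m(2) by (metis dvd_add)
  qed auto
qed simp

lemma qbinomial_mult:
  assumes "k \<le> n"
  shows "qbinomial n k * (qpoch qvar qvar k * qpoch qvar qvar (n - k)) = qpoch qvar qvar n"
  using qpoch_mult_qpoch_dvd[OF assms, of qvar] assms by (simp add: qbinomial_def)

lemma qbracket_mult: "qbracket n * (1 - qvar) = 1 - qvar ^ n"
proof -
  have "1 - qvar dvd 1 - qvar ^ n"
    unfolding one_diff_power_eq[of qvar n] by (rule dvd_triv_left)
  thus ?thesis unfolding qbracket_def by (rule dvd_div_mult_self)
qed

lemma qbracket_mult_qbinomial_diff:
  "(qbinomial (2 * n) n - qvar * qbinomial (2 * n) (n + 1)) * qbracket (n + 1) = qbinomial (2 * n) n"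
proof (cases "n = 0")
  case True
  have "qbracket 1 = 1"
    using qbracket_mult[of 1] one_minus_qvar_power_nonzero[of 1] 
    by (metis mult_cancel_right1 power_one_right zero_less_one)
  then show ?thesis using True by (simp add: qbinomial_def)
next
  case False
  then obtain m where m: "n = Suc m" by (cases n) auto
  define B where "B = qbinomial (2 * n) n"
  define B' where "B' = qbinomial (2 * n) (n + 1)"
  define P where "P = qpoch qvar qvar"
  have sub: "2 * n - (n + 1) = m" "2 * n - n = n" using m by auto
  have Pn: "P n = P m * (1 - qvar ^ n)" and PSn: "P (n + 1) = P n * (1 - qvar ^ (n + 1))"
    unfolding P_def m by (simp_all only: qpoch_Suc Suc_eq_plus1[symmetric])
  have "B * (P n * P n) = P (2 * n)" "B' * (P (n + 1) * P m) = P (2 * n)"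
    using qbinomial_mult[of n "2 * n"] qbinomial_mult[of "n + 1" "2 * n"] False sub
    by (simp_all add: B_def B'_def P_def)
  hence "B * (P n * (P m * (1 - qvar ^ n))) = B' * (P n * (1 - qvar ^ (n + 1)) * P m)"
    using Pn PSn by metis
  hence "(P n * P m) * (B * (1 - qvar ^ n)) = (P n * P m) * (B' * (1 - qvar ^ (n + 1)))"
    by (simp only: mult_ac)
  moreover have "P n * P m \<noteq> 0"
    by (simp add: P_def qpoch_qvar_nonzero)
  ultimately have eq: "B * (1 - qvar ^ n) = B' * (1 - qvar ^ (n + 1))"
    using mult_left_cancel by blast
  have "(B - qvar * B') * qbracket (n + 1) * (1 - qvar) = (B - qvar * B') * (1 - qvar ^ (n + 1))"
    by (simp only: mult.assoc qbracket_mult)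
  also have "\<dots> = B * (1 - qvar ^ (n + 1)) - qvar * (B' * (1 - qvar ^ (n + 1)))"
    by (simp only: left_diff_distrib mult.assoc)
  also have "\<dots> = B * (1 - qvar ^ (n + 1)) - qvar * (B * (1 - qvar ^ n))"
    by (simp only: eq)
  also have "\<dots> = B * (1 - qvar)"
    by (simp only: right_diff_distrib power_add power_one_right mult_1_right mult_ac)
  finally show ?thesis
    using one_minus_qvar_power_nonzero[of 1] unfolding B_def B'_def
    by (metis mult_right_cancel power_one_right zero_less_one)
qed

lemma qcatalan_mult: "qcatalan n * qbracket (n + 1) = qbinomial (2 * n) n"
  unfolding qcatalan_def using qbracket_mult_qbinomial_diff[of n]
  by (metis dvd_div_mult_self dvd_triv_right)

lemma qcatalan_eq_diff: "qcatalan n = qbinomial (2 * n) n - qvar * qbinomial (2 * n) (n + 1)"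
proof -
  have "qbracket (n + 1) \<noteq> 0"
    using qbracket_mult[of "n + 1"] one_minus_qvar_power_nonzero[of "n + 1"]
    by (metis add_gr_0 mult_zero_left zero_less_one)
  moreover have "qcatalan n * qbracket (n + 1) =
      (qbinomial (2 * n) n - qvar * qbinomial (2 * n) (n + 1)) * qbracket (n + 1)"
    by (simp only: qcatalan_mult qbracket_mult_qbinomial_diff)
  ultimately show ?thesis using mult_right_cancel by blast
qed

definition complex_cyclotomic :: "nat \<Rightarrow> complex poly" where
  "complex_cyclotomic n =
     (\<Prod>m\<in>{m. m < n \<and> coprime m n}. [:- exp (2 * of_real pi * \<i> * of_nat m / of_nat n), 1:])"

text \<open>
  The product has integer coefficients (\<open>map_poly_cyclotomic\<close> below), so it is the image of a
  unique integer polynomial.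
\<close>

definition cyclotomic :: "nat \<Rightarrow> int poly" where
  "cyclotomic n = (THE p. map_poly of_int p = complex_cyclotomic n)"

lemma map_poly_of_int_mult:
  "map_poly of_int (p * q) = (map_poly of_int p * map_poly of_int q :: complex poly)"
  by (intro poly_eqI) (simp add: coeff_map_poly coeff_mult)

lemma map_poly_of_int_add:
  "map_poly of_int (p + q) = (map_poly of_int p + map_poly of_int q :: complex poly)"
  by (intro poly_eqI) (simp add: coeff_map_poly)

lemma map_poly_of_int_inject:
  "map_poly of_int p = (map_poly of_int q :: complex poly) \<longleftrightarrow> p = q"
  by (simp add: poly_eq_iff coeff_map_poly)

lemma degree_map_poly_of_int: "degree (map_poly of_int p :: complex poly) = degree p"
  by (rule degree_map_poly) simp

lemma prod_roots_unity:
  assumes "n > 0"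
  shows "(\<Prod>m<n. [:- exp (2 * of_real pi * \<i> * of_nat m / of_nat n), 1:]) = (monom 1 n - 1 :: complex poly)"
    (is "?P = ?Q")
proof -
  define f where "f = (\<lambda>m::nat. exp (2 * of_real pi * \<i> * of_nat m / of_nat n) :: complex)"
  have "f = (\<lambda>m. cis (2 * pi * real m / real n))"
    by (auto simp: f_def cis_conv_exp mult_ac)
  hence bij: "bij_betw f {..<n} {z. z ^ n = 1}"
    using bij_betw_roots_unity[OF assms] by simp
  have deg: "degree (\<Prod>m<n. [:- f m, 1:]) = n"
    by (subst degree_prod_sum_eq) auto
  have "lead_coeff (\<Prod>m<n. [:- f m, 1:]) = 1"
    by (simp add: lead_coeff_prod)
  hence "coeff (\<Prod>m<n. [:- f m, 1:]) n = coeff ?Q n"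
    using assms deg by simp
  moreover have "poly (\<Prod>m<n. [:- f m, 1:]) z = poly ?Q z" if "z \<in> f ` {..<n}" for z
  proof -
    have "z ^ n = 1" using that bij by (auto simp: bij_betw_def)
    moreover have "poly (\<Prod>m<n. [:- f m, 1:]) z = 0"
      using that by (auto simp: poly_prod)
    ultimately show ?thesis by (simp add: poly_monom)
  qed
  moreover have "degree ?Q \<le> n"
    by (intro degree_diff_le) (auto simp: degree_monom_eq)
  moreover have "card (f ` {..<n}) = n"
    using bij_betw_same_card[OF bij] bij by (simp add: bij_betw_def)
  ultimately have "(\<Prod>m<n. [:- f m, 1:]) = ?Q"
    using deg by (intro poly_eqI_degree_lead_coeff[of _ n _ "f ` {..<n}"]) auto
  thus ?thesis by (simp add: f_def)
qed

lemma prod_complex_cyclotomic: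
  assumes "n > 0"
  shows "(\<Prod>d\<in>{d. d dvd n}. complex_cyclotomic d) = monom 1 n - 1"
proof -
  define f where
    "f = (\<lambda>n m::nat. [:- exp (2 * of_real pi * \<i> * of_nat m / of_nat n), 1:] :: complex poly)"
  have "(\<Prod>m<n. f n m) = (\<Prod>d\<in>{d. d dvd n}. \<Prod>m\<in>{m\<in>{..<n}. n div gcd m n = d}. f n m)"
    using assms by (intro prod.group[symmetric]) (auto intro: div_dvd_iff_mult[THEN iffD2])
  also have "\<dots> = (\<Prod>d\<in>{d. d dvd n}. complex_cyclotomic d)"
  proof (intro prod.cong refl)
    fix d assume "d \<in> {d. d dvd n}"
    then obtain e where n: "n = d * e" by auto
    hence pos: "d > 0" "e > 0" using assms by auto
    show "(\<Prod>m\<in>{m\<in>{..<n}. n div gcd m n = d}. f n m) = complex_cyclotomic d"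
      unfolding complex_cyclotomic_def f_def
    proof (intro prod.reindex_bij_witness[of _ "\<lambda>m. m * e" "\<lambda>m. m div e"])
      fix m assume "m \<in> {m\<in>{..<n}. n div gcd m n = d}"
      hence m: "m < n" "n div gcd m n = d" by auto
      have "d * gcd m n = d * e" using m(2) n by (metis dvd_div_mult_self gcd_dvd2)
      hence g: "gcd m n = e" using pos by simp
      then obtain l where l: "m = e * l" by (metis gcd_dvd1 dvdE)
      have "coprime l d"
        using g pos unfolding l n by (simp add: gcd_mult_left mult.commute[of d e] coprime_iff_gcd_eq_1)
      thus "m div e \<in> {m. m < d \<and> coprime m d}" "m div e * e = m"
        "[:- exp (2 * complex_of_real pi * \<i> * of_nat (m div e) / of_nat d), 1:] =
         [:- exp (2 * complex_of_real pi * \<i> * of_nat m / of_nat n), 1:]"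
        using l m(1) n pos by (auto simp: field_simps)
    next
      fix m assume "m \<in> {m. m < d \<and> coprime m d}"
      hence m: "m < d" "coprime m d" by auto
      hence "gcd (m * e) n = e"
        unfolding n by (metis coprime_iff_gcd_eq_1 gcd_mult_distrib_nat mult.commute mult.right_neutral)
      thus "m * e \<in> {m\<in>{..<n}. n div gcd m n = d}" "m * e div e = m"
        using m(1) pos n by auto
    qed
  qed
  finally show ?thesis
    using prod_roots_unity[OF assms] by (simp add: f_def)
qed

lemma monic_complex_cyclotomic: "lead_coeff (complex_cyclotomic n) = 1"
  by (simp add: complex_cyclotomic_def lead_coeff_prod)

lemma ex_int_complex_cyclotomic: "\<exists>p. map_poly of_int p = complex_cyclotomic n"
proof (induction n rule: less_induct)
  case (less n)
  show ?case
  proof (cases "n = 0")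
    case True
    thus ?thesis by (intro exI[of _ 1]) (simp add: complex_cyclotomic_def)
  next
    case False
    define D where "D = {d. d dvd n \<and> d \<noteq> n}"
    have fin: "finite D" using False by (auto simp: D_def)
    have "d < n" if "d \<in> D" for d
      using that False by (auto simp: D_def intro: le_neq_implies_less dvd_imp_le)
    then obtain p where p: "\<And>d. d \<in> D \<Longrightarrow> map_poly of_int (p d) = complex_cyclotomic d"
      using less.IH by metis
    define g where "g = (\<Prod>d\<in>D. p d)"
    have "map_poly of_int (\<Prod>d\<in>E. p d) = (\<Prod>d\<in>E. complex_cyclotomic d)" if "E \<subseteq> D" for E
    proof -
      have "finite E" using that fin finite_subset by blast
      thus ?thesis using that p by induction (auto simp: map_poly_of_int_mult)
    qed
    hence g: "map_poly of_int g = (\<Prod>d\<in>D. complex_cyclotomic d)" by (simp add: g_def)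
    have "lead_coeff (map_poly of_int g :: complex poly) = 1"
      unfolding g by (simp add: lead_coeff_prod monic_complex_cyclotomic)
    hence monic: "lead_coeff g = 1"
      by (simp add: degree_map_poly_of_int coeff_map_poly)
    hence g0: "g \<noteq> 0" by auto
    obtain s r where sr: "pseudo_divmod (monom 1 n - 1) g = (s, r)" by force
    from pseudo_divmod[OF g0 sr] monic
    have div: "monom 1 n - 1 = g * s + r" and r: "r = 0 \<or> degree r < degree g" by auto
    have "{d. d dvd n} = insert n D" "n \<notin> D" by (auto simp: D_def)
    hence "map_poly of_int g * complex_cyclotomic n = monom 1 n - 1"
      using prod_complex_cyclotomic[of n] False fin g by (simp add: mult.commute)
    also have "\<dots> = map_poly of_int (monom 1 n - 1)"
      by (intro poly_eqI) (simp add: coeff_map_poly coeff_1)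
    also have "\<dots> = map_poly of_int g * map_poly of_int s + map_poly of_int r"
      unfolding div by (simp add: map_poly_of_int_mult map_poly_of_int_add)
    finally have eq: "map_poly of_int g * (complex_cyclotomic n - map_poly of_int s) = map_poly of_int r"
      by (simp add: algebra_simps)
    have "complex_cyclotomic n - map_poly of_int s = 0"
    proof (rule ccontr)
      assume nz: "complex_cyclotomic n - map_poly of_int s \<noteq> 0"
      have gC: "map_poly of_int g \<noteq> (0 :: complex poly)"
        using g0 map_poly_of_int_inject[of g 0] by simp
      have "r \<noteq> 0" using eq nz gC by auto
      moreover have "degree r = degree g + degree (complex_cyclotomic n - map_poly of_int s)"
        using degree_mult_eq[OF gC nz] eq by (simp add: degree_map_poly_of_int)
      ultimately show False using r by simp
    qed
    thus ?thesis by (intro exI[of _ s]) simp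
  qed
qed

lemma map_poly_cyclotomic: "map_poly of_int (cyclotomic n) = complex_cyclotomic n"
proof -
  have "\<exists>!p. map_poly of_int p = complex_cyclotomic n"
    using ex_int_complex_cyclotomic[of n] map_poly_of_int_inject by metis
  thus ?thesis unfolding cyclotomic_def by (rule theI')
qed

end

theory Submission
  imports Defs
begin

text \<open>
  It suffices to evaluate the sum at every primitive \<open>n\<close>-th root of unity \<open>w\<close>. Put \<open>p = 1/w\<close>. Since
  \<open>w^n = 1\<close>, each factor \<open>1 - w^(c + i)\<close> of a Gaussian binomial equals \<open>1 - p^(n - c - i)\<close>, which
  turns \<open>[c + j; j]\<close> at \<open>w\<close> into \<open>\<plusminus> [n - 1 - c; j]\<close> at \<open>p\<close>, up to a power of \<open>p\<close>. The sum of
  \<open>w^k [2k; k]\<close> becomes \<open>F (n - 1)\<close> and that of \<open>w^(k + 1) [2k; k + 1]\<close> becomes \<open>F (n + 1)\<close>, where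
  \<open>F N\<close> is the sum of \<open>(-1)^k p^(k choose 2) [N - k; k]\<close> over \<open>k\<close>. The two \<open>q\<close>-Pascal rules give
  \<open>F (N + 3) = - p^(N + 1) F N\<close>, so \<open>F N\<close> is 0 or a signed power of \<open>p\<close>. The exponents are compared
  by the residue of \<open>n\<close> modulo 6, because a half period contributes the sign \<open>p^(n/2) = -1\<close>.
\<close>

section \<open>Gaussian binomial coefficients over a commutative ring\<close>

text \<open>The recursion involves no division, so it makes sense at a root of unity, where the
  quotient of \<open>qpoch\<close> values may become 0/0.\<close>

fun gauss_binomial :: "'a::comm_ring_1 \<Rightarrow> nat \<Rightarrow> nat \<Rightarrow> 'a" where
  "gauss_binomial q n 0 = 1"
| "gauss_binomial q 0 (Suc k) = 0"
| "gauss_binomial q (Suc n) (Suc k) =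
     gauss_binomial q n k + q ^ Suc k * gauss_binomial q n (Suc k)"

lemma gauss_binomial_eq_0: "n < k \<Longrightarrow> gauss_binomial q n k = 0"
  by (induction q n k rule: gauss_binomial.induct) auto

text \<open>Passes from the ratio rule within row n to the absorption rule between rows n and n + 1.
  The ratio rule is a hypothesis here so that its own inductive proof can use this step.\<close>

lemma gauss_binomial_Suc_right_aux:
  fixes q :: "'a::comm_ring_1"
  assumes "gauss_binomial q n (Suc k) * (1 - q ^ Suc k) = gauss_binomial q n k * (1 - q ^ (n - k))"
  shows "gauss_binomial q (Suc n) (Suc k) * (1 - q ^ Suc k) = gauss_binomial q n k * (1 - q ^ Suc n)"
proof (cases "k \<le> n")
  case True
  have "q ^ Suc k * q ^ (n - k) = q ^ Suc n"
    using True by (simp only: power_add[symmetric]) simp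
  moreover have "gauss_binomial q (Suc n) (Suc k) * (1 - q ^ Suc k) =
      gauss_binomial q n k * (1 - q ^ Suc k)
      + q ^ Suc k * (gauss_binomial q n (Suc k) * (1 - q ^ Suc k))"
    by (simp add: algebra_simps)
  ultimately show ?thesis
    unfolding assms by (simp add: algebra_simps)
qed (simp add: gauss_binomial_eq_0)

lemma gauss_binomial_Suc_right:
  fixes q :: "'a::comm_ring_1"
  shows "gauss_binomial q n (Suc k) * (1 - q ^ Suc k) = gauss_binomial q n k * (1 - q ^ (n - k))"
proof (induction n arbitrary: k)
  case (Suc n)
  show ?case
  proof (cases k)
    case 0
    then show ?thesis
      using gauss_binomial_Suc_right_aux[OF Suc.IH[of 0]] by simp
  next
    case (Suc l)
    show ?thesis
    proof (cases "l < n")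
      case True
      have pow: "q ^ Suc l * q ^ (n - l) = q ^ Suc n"
        using True by (simp only: power_add[symmetric]) simp
      have "gauss_binomial q (Suc n) (Suc k) * (1 - q ^ Suc k) =
          gauss_binomial q n (Suc l) * (1 - q ^ Suc n)"
        using gauss_binomial_Suc_right_aux[OF Suc.IH[of k]] Suc by simp
      \<comment> \<open>Splits 1 - q^(n+1) as (1 - q^(l+1)) + q^(l+1) (1 - q^(n-l)); the induction
        hypothesis for l then exposes the Pascal rule.\<close>
      also have "\<dots> = gauss_binomial q n (Suc l) * (1 - q ^ Suc l)
          + q ^ Suc l * gauss_binomial q n (Suc l) * (1 - q ^ (n - l))"
        unfolding pow[symmetric] by (simp add: algebra_simps)
      also have "\<dots> = gauss_binomial q (Suc n) (Suc l) * (1 - q ^ (n - l))"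
        unfolding Suc.IH by (simp add: algebra_simps)
      finally show ?thesis using Suc by simp
    qed (simp add: Suc gauss_binomial_eq_0)
  qed
qed simp

lemma gauss_binomial_Suc_Suc_mult:
  fixes q :: "'a::comm_ring_1"
  shows "gauss_binomial q (Suc n) (Suc k) * (1 - q ^ Suc k) = gauss_binomial q n k * (1 - q ^ Suc n)"
  by (rule gauss_binomial_Suc_right_aux[OF gauss_binomial_Suc_right])

text \<open>The two Pascal rules differ exactly by the ratio rule, so nothing has to be
  cancelled.\<close>

lemma gauss_binomial_Suc_Suc':
  fixes q :: "'a::comm_ring_1"
  shows "gauss_binomial q (Suc n) (Suc k) =
    gauss_binomial q n (Suc k) + q ^ (n - k) * gauss_binomial q n k"
  using gauss_binomial_Suc_right[of q n k] by (simp add: algebra_simps)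

lemma gauss_binomial_same [simp]: "gauss_binomial q n n = 1"
  by (induction n) (simp_all add: gauss_binomial_eq_0)

lemma gauss_binomial_symmetric: "k \<le> n \<Longrightarrow> gauss_binomial q n (n - k) = gauss_binomial q n k"
proof (induction n arbitrary: k)
  case (Suc n)
  show ?case
  proof (cases "k = 0 \<or> k = Suc n")
    case False
    then obtain l where k: "k = Suc l" "l < n"
      using Suc.prems by (cases k) auto
    define m where "m = n - k"
    have m: "Suc n - k = Suc m" "n - m = k" "n - l = Suc m" using k by (auto simp: m_def)
    have "gauss_binomial q (Suc n) (Suc m) =
        gauss_binomial q n (n - l) + q ^ k * gauss_binomial q n (n - k)"
      by (simp only: gauss_binomial_Suc_Suc' m) (simp only: m_def)
    also have "\<dots> = gauss_binomial q (Suc n) k"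
      using Suc.IH[of l] Suc.IH[of k] k by simp
    finally show ?thesis by (simp only: m)
  qed auto
qed simp

lemma gauss_binomial_mult_qpoch:
  fixes q :: "'a::comm_ring_1"
  shows "gauss_binomial q (k + m) k * (qpoch q q k * qpoch q q m) = qpoch q q (k + m)"
proof (induction k)
  case (Suc k)
  have "gauss_binomial q (Suc k + m) (Suc k) * (qpoch q q (Suc k) * qpoch q q m) =
      gauss_binomial q (Suc (k + m)) (Suc k) * (1 - q ^ Suc k) * (qpoch q q k * qpoch q q m)"
    by (simp only: qpoch_Suc mult_ac add_Suc)
  also have "\<dots> = gauss_binomial q (k + m) k * (qpoch q q k * qpoch q q m) * (1 - q ^ Suc (k + m))"
    unfolding gauss_binomial_Suc_Suc_mult by (simp only: mult_ac)
  finally show ?case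
    by (simp only: Suc.IH qpoch_Suc add_Suc)
qed simp

lemma qbinomial_eq_gauss_binomial: "qbinomial n k = gauss_binomial qvar n k"
proof (cases "k \<le> n")
  case True
  then have "qbinomial n k * (qpoch qvar qvar k * qpoch qvar qvar (n - k)) =
      gauss_binomial qvar n k * (qpoch qvar qvar k * qpoch qvar qvar (n - k))"
    using qbinomial_mult[OF True] gauss_binomial_mult_qpoch[of qvar k "n - k"] by simp
  then show ?thesis
    using qpoch_qvar_nonzero by (metis mult_right_cancel no_zero_divisors)
qed (simp add: qbinomial_def gauss_binomial_eq_0)

section \<open>An alternating sum of Gaussian binomial coefficients\<close>

text \<open>At q = 1 this is the alternating sum of (n - k choose k), which has period 6 in n. Terms
  with 2k > n vanish.\<close>

definition alt_gauss_sum :: "'a::comm_ring_1 \<Rightarrow> nat \<Rightarrow> 'a" where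
  "alt_gauss_sum q n = (\<Sum>k\<le>n. (-1) ^ k * q ^ (k choose 2) * gauss_binomial q (n - k) k)"

text \<open>A companion with an extra factor q^k in each term. Each Pascal rule relates it to
  \<open>alt_gauss_sum\<close>, and the two relations eliminate it again.\<close>

definition alt_gauss_sum' :: "'a::comm_ring_1 \<Rightarrow> nat \<Rightarrow> 'a" where
  "alt_gauss_sum' q n = (\<Sum>k\<le>n. (-1) ^ k * q ^ (Suc k choose 2) * gauss_binomial q (n - k) k)"

lemma alt_gauss_sum_diff:
  "alt_gauss_sum q (Suc (Suc n)) = alt_gauss_sum' q (Suc n) - alt_gauss_sum' q n"
proof -
  have ch: "Suc j choose 2 = (j choose 2) + j" for j
    by (simp add: numeral_2_eq_2)
  have "alt_gauss_sum q (Suc (Suc n)) =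
      1 + (\<Sum>j\<le>n. (-1) ^ Suc j * q ^ (Suc j choose 2) * gauss_binomial q (Suc (n - j)) (Suc j))"
    unfolding alt_gauss_sum_def sum.atMost_Suc_shift[of _ "Suc n"]
    by (simp add: Suc_diff_le binomial_eq_0 flip: One_nat_def)
  also have "\<dots> = 1 + (\<Sum>j\<le>n. (-1) ^ Suc j * q ^ (Suc (Suc j) choose 2) * gauss_binomial q (n - j) (Suc j))
      - alt_gauss_sum' q n"
    unfolding alt_gauss_sum'_def 
    by (simp add: ch[of "Suc _"] power_add algebra_simps sum.distrib sum_negf sum_subtractf)
  also have "1 + (\<Sum>j\<le>n. (-1) ^ Suc j * q ^ (Suc (Suc j) choose 2) * gauss_binomial q (n - j) (Suc j))
      = alt_gauss_sum' q (Suc n)"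
    unfolding alt_gauss_sum'_def sum.atMost_Suc_shift[of _ n] by (simp add: binomial_eq_0)
  finally show ?thesis .
qed

lemma alt_gauss_sum'_diff:
  "alt_gauss_sum' q (Suc (Suc n)) - alt_gauss_sum' q (Suc n) = - (q ^ Suc n * alt_gauss_sum q n)"
proof -
  have ch: "Suc j choose 2 = (j choose 2) + j" for j
    by (simp add: numeral_2_eq_2)
  \<comment> \<open>Uses (j + 2 choose 2) = (j choose 2) + 2j + 1. For 2j > n the subtraction
    truncates, but the binomial is 0.\<close>
  have pow: "q ^ (Suc (Suc j) choose 2) * (q ^ (n - j - j) * gauss_binomial q (n - j) j) =
      q ^ Suc n * (q ^ (j choose 2) * gauss_binomial q (n - j) j)" for j
  proof (cases "j + j \<le> n")
    case True
    then have "(Suc (Suc j) choose 2) + (n - j - j) = Suc n + (j choose 2)"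
      by (simp add: ch)
    then show ?thesis by (metis mult.assoc power_add)
  qed (simp add: gauss_binomial_eq_0)
  have "alt_gauss_sum' q (Suc (Suc n)) =
      1 + (\<Sum>j\<le>n. (-1) ^ Suc j * q ^ (Suc (Suc j) choose 2) * gauss_binomial q (Suc (n - j)) (Suc j))"
    unfolding alt_gauss_sum'_def sum.atMost_Suc_shift[of _ "Suc n"]
    by (simp add: Suc_diff_le binomial_eq_0 flip: One_nat_def)
  also have "\<dots> = 1 + (\<Sum>j\<le>n. (-1) ^ Suc j * q ^ (Suc (Suc j) choose 2) * gauss_binomial q (n - j) (Suc j))
      + (\<Sum>j\<le>n. (-1) ^ Suc j *
          (q ^ (Suc (Suc j) choose 2) * (q ^ (n - j - j) * gauss_binomial q (n - j) j)))"
    unfolding gauss_binomial_Suc_Suc' by (simp only: distrib_left sum.distrib mult.assoc add.assoc)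
  also have "1 + (\<Sum>j\<le>n. (-1) ^ Suc j * q ^ (Suc (Suc j) choose 2) * gauss_binomial q (n - j) (Suc j))
      = alt_gauss_sum' q (Suc n)"
    unfolding alt_gauss_sum'_def sum.atMost_Suc_shift[of _ n] by (simp add: binomial_eq_0)
  also have "(\<Sum>j\<le>n. (-1) ^ Suc j *
          (q ^ (Suc (Suc j) choose 2) * (q ^ (n - j - j) * gauss_binomial q (n - j) j)))
      = - (q ^ Suc n * alt_gauss_sum q n)"
    unfolding pow alt_gauss_sum_def by (simp add: sum_distrib_left sum_negf mult_ac)
  finally show ?thesis by simp
qed

text \<open>Both relations contain the same difference of companion sums.\<close>

lemma alt_gauss_sum_add_3: "alt_gauss_sum q (n + 3) = - (q ^ (n + 1) * alt_gauss_sum q n)"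
  using alt_gauss_sum_diff[of q "Suc n"] alt_gauss_sum'_diff[of q n]
  by (simp add: numeral_3_eq_3)

section \<open>Closed forms by residue of the index\<close>

lemma alt_gauss_sum_3_mult_add_2: "alt_gauss_sum q (3 * m + 2) = 0"
proof (induction m)
  case 0
  show ?case by (simp add: alt_gauss_sum_def numeral_2_eq_2)
next
  case (Suc m)
  have "3 * Suc m + 2 = (3 * m + 2) + 3" by simp
  then show ?case by (simp only: alt_gauss_sum_add_3 Suc.IH) simp
qed

lemma alt_gauss_sum_add_6: "alt_gauss_sum q (n + 6) = q ^ (2 * n + 5) * alt_gauss_sum q n"
proof -
  have "n + 6 = (n + 3) + 3" "2 * n + 5 = (n + 3 + 1) + (n + 1)" by simp_all
  then show ?thesis
    by (simp only: alt_gauss_sum_add_3 power_add) simp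
qed

text \<open>The exponent should be 6r^2 - r; the factor q^r avoids both subtraction and inverting
  q.\<close>

lemma alt_gauss_sum_6_mult: "alt_gauss_sum q (6 * r) * q ^ r = q ^ (6 * r * r)"
proof (induction r)
  case 0
  show ?case by (simp add: alt_gauss_sum_def binomial_eq_0)
next
  case (Suc r)
  have "6 * Suc r = 6 * r + 6" "2 * (6 * r) + 6 = Suc (2 * (6 * r) + 5)" by simp_all
  then have "alt_gauss_sum q (6 * Suc r) * q ^ Suc r =
      q ^ (2 * (6 * r) + 6) * (alt_gauss_sum q (6 * r) * q ^ r)"
    by (simp only: alt_gauss_sum_add_6 power_Suc mult_ac)
  also have "\<dots> = q ^ (6 * Suc r * Suc r)"
    unfolding Suc.IH by (simp flip: power_add add: algebra_simps)
  finally show ?case .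
qed

lemma alt_gauss_sum_6_mult_add_1: "alt_gauss_sum q (6 * r + 1) = q ^ (6 * r * r + r)"
proof (induction r)
  case 0
  show ?case by (simp add: alt_gauss_sum_def binomial_eq_0)
next
  case (Suc r)
  have "alt_gauss_sum q (6 * Suc r + 1) = q ^ (2 * (6 * r + 1) + 5) * alt_gauss_sum q (6 * r + 1)"
    using alt_gauss_sum_add_6[of q "6 * r + 1"] by (simp add: algebra_simps)
  also have "\<dots> = q ^ (6 * Suc r * Suc r + Suc r)"
    unfolding Suc.IH by (simp flip: power_add add: algebra_simps)
  finally show ?case .
qed

section \<open>Values at a primitive root of unity\<close>

locale primitive_root =
  fixes w :: complex and n :: nat
  assumes n_ge_2: "n \<ge> 2"
    and power_n: "w ^ n = 1"
    and power_neq_1: "0 < i \<Longrightarrow> i < n \<Longrightarrow> w ^ i \<noteq> 1"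
begin

abbreviation p :: complex where "p \<equiv> inverse w"

lemma w_neq_0: "w \<noteq> 0"
  using power_n n_ge_2 by (auto simp: power_0_left)

lemma w_p_power: "w ^ i * p ^ i = 1"
  using w_neq_0 by (simp flip: power_mult_distrib)

lemma p_power_n: "p ^ n = 1"
  by (simp add: power_inverse power_n)

lemma p_power_diff: "i \<le> n \<Longrightarrow> p ^ (n - i) = w ^ i"
  using w_neq_0 p_power_n by (simp add: power_diff power_inverse field_simps)

lemma p_power_half: "n = 2 * h \<Longrightarrow> p ^ h = -1"
proof -
  assume h: "n = 2 * h"
  then have "(p ^ h)\<^sup>2 = 1" using p_power_n by (simp add: mult.commute flip: power_mult)
  moreover have "p ^ h \<noteq> 1"
    using h n_ge_2 power_neq_1[of h] by (simp add: power_inverse)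
  ultimately show ?thesis by (simp add: power2_eq_1_iff)
qed

text \<open>Going from j to j + 1 multiplies the left side by (1 - w^(c+j+1)) / (1 - w^(j+1)).
  Rewriting the denominator in p contributes -p^(j+1), and these factors accumulate to the sign and
  the power of p. The bound j < n keeps the denominators nonzero.\<close>

lemma gauss_binomial_reflect:
  assumes "c < n" "j < n"
  shows "gauss_binomial w (c + j) j =
    (-1) ^ j * p ^ (Suc j choose 2) * gauss_binomial p (n - 1 - c) j"
  using assms(2)
proof (induction j)
  case (Suc j)
  let ?N = "n - 1 - c"
  have ch: "Suc (Suc j) choose 2 = (Suc j choose 2) + Suc j"
    by (simp add: numeral_2_eq_2)
  have nz: "1 - w ^ Suc j \<noteq> 0"
    using power_neq_1[of "Suc j"] Suc.prems by simp
  have flip: "p ^ Suc j * (1 - w ^ Suc j) = - (1 - p ^ Suc j)"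
    using w_p_power[of "Suc j"] by (simp only: right_diff_distrib mult.commute) simp
  \<comment> \<open>For c + j >= n the exponent truncates, but then the binomial at p
    vanishes.\<close>
  have top: "gauss_binomial p ?N j * (1 - p ^ (?N - j)) = gauss_binomial p ?N j * (1 - w ^ Suc (c + j))"
  proof (cases "j \<le> ?N")
    case True
    then have "?N - j = n - Suc (c + j)" "Suc (c + j) \<le> n"
      using assms(1) by auto
    then show ?thesis using p_power_diff by metis
  qed (simp add: gauss_binomial_eq_0)
  have "gauss_binomial w (c + Suc j) (Suc j) * (1 - w ^ Suc j) =
      gauss_binomial w (c + j) j * (1 - w ^ Suc (c + j))"
    using gauss_binomial_Suc_Suc_mult[of w "c + j" j] by simp
  also have "\<dots> = (-1) ^ j * p ^ (Suc j choose 2) * (gauss_binomial p ?N j * (1 - w ^ Suc (c + j)))"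
    using Suc by (simp only: Suc_lessD mult.assoc)
  also have "\<dots> = (-1) ^ j * p ^ (Suc j choose 2) * (gauss_binomial p ?N (Suc j) * (1 - p ^ Suc j))"
    by (simp only: top[symmetric] gauss_binomial_Suc_right)
  also have "\<dots> = (-1) ^ Suc j * p ^ (Suc j choose 2) * gauss_binomial p ?N (Suc j) * (- (1 - p ^ Suc j))"
    by (simp only: power_Suc[of "-1"]) (simp only: mult_minus_left mult_minus_right mult_1_left minus_minus mult_ac)
  also have "\<dots> = (-1) ^ Suc j * p ^ (Suc (Suc j) choose 2) * gauss_binomial p ?N (Suc j) * (1 - w ^ Suc j)"
    by (simp only: flip[symmetric] ch power_add mult_ac)
  finally show ?case using nz mult_right_cancel by blast
qed (simp add: binomial_eq_0)

text \<open>By periodicity each numerator factor 1 - w^(n+i) cancels the denominator factor 1 -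
  w^i.\<close>

lemma gauss_binomial_n_add: "j < n \<Longrightarrow> gauss_binomial w (n + j) j = 1"
proof (induction j)
  case (Suc j)
  have "1 - w ^ Suc j \<noteq> 0"
    using power_neq_1[of "Suc j"] Suc.prems by simp
  moreover have "gauss_binomial w (n + Suc j) (Suc j) * (1 - w ^ Suc j) = 1 * (1 - w ^ Suc j)"
    using gauss_binomial_Suc_Suc_mult[of w "n + j" j] Suc power_n
    by (simp add: power_add)
  ultimately show ?case using mult_right_cancel by blast
qed simp

lemma w_p_power_choose: "w ^ k * p ^ (Suc k choose 2) = p ^ (k choose 2)"
proof -
  have "Suc k choose 2 = k + (k choose 2)" by (simp add: numeral_2_eq_2)
  then show ?thesis using w_p_power[of k] by (simp add: power_add flip: mult.assoc)
qed

lemma sum_central: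
  "(\<Sum>k\<le>n-1. w ^ k * gauss_binomial w (2 * k) k) = alt_gauss_sum p (n - 1)"
  unfolding alt_gauss_sum_def
proof (intro sum.cong refl)
  fix k assume "k \<in> {..n - 1}"
  then have "k < n" using n_ge_2 by auto
  then have "w ^ k * gauss_binomial w (2 * k) k =
      (-1) ^ k * (w ^ k * p ^ (Suc k choose 2)) * gauss_binomial p (n - 1 - k) k"
    using gauss_binomial_reflect[of k k] by (simp only: mult_2) (simp only: mult_ac)
  then show "w ^ k * gauss_binomial w (2 * k) k =
      (-1) ^ k * p ^ (k choose 2) * gauss_binomial p (n - 1 - k) k"
    by (simp only: w_p_power_choose)
qed

text \<open>
  For \<open>k < n - 1\<close> the terms are the terms of index \<open>k + 1\<close> of \<open>alt_gauss_sum p (n + 1)\<close>; the term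
  \<open>k = n - 1\<close>, to which the reflection does not apply, compensates the missing term of index 0.
\<close>

lemma sum_off_central:
  "(\<Sum>k\<le>n-1. w ^ Suc k * gauss_binomial w (2 * k) (Suc k)) = alt_gauss_sum p (n + 1)"
proof -
  define t where "t l = (-1) ^ l * p ^ (l choose 2) * gauss_binomial p (n + 1 - l) l" for l
  obtain m where m: "n = Suc (Suc m)" using n_ge_2 by (metis add_2_eq_Suc le_Suc_ex)
  have "w ^ Suc k * gauss_binomial w (2 * k) (Suc k) = t (Suc k)" if "k \<le> m" for k
  proof (cases k)
    \<comment> \<open>No reflection is available, as c would be -1. Both sides are 0, because [n; 1]
      at p is a full geometric sum over the powers of p.\<close>
    case 0
    have "gauss_binomial p n (Suc 0) * (1 - p) = 0"
      using gauss_binomial_Suc_right[of p n 0] p_power_n by simp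
    moreover have "1 - p \<noteq> 0"
      using power_neq_1[of 1] n_ge_2 by auto
    ultimately show ?thesis using 0 by (simp add: t_def)
  next
    case (Suc l)
    have "w ^ Suc k * gauss_binomial w (2 * k) (Suc k) =
      (-1) ^ Suc k * (w ^ Suc k * p ^ (Suc (Suc k) choose 2)) * gauss_binomial p (n - 1 - l) (Suc k)"
    proof -
      have "l + Suc k = 2 * k" using Suc by simp
      then show ?thesis
        using gauss_binomial_reflect[of l "Suc k"] Suc that m by (simp only: mult_ac)
    qed
    moreover have "n - 1 - l = n + 1 - Suc k" using Suc by simp
    ultimately show ?thesis by (simp only: w_p_power_choose t_def)
  qed
  then have "(\<Sum>k\<le>m. w ^ Suc k * gauss_binomial w (2 * k) (Suc k)) = (\<Sum>k\<le>m. t (Suc k))"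
    by simp
  \<comment> \<open>The term k = n - 1: by symmetry [2n - 2; n] = [2n - 2; n - 2] = 1, and its
    weight is w^n = 1, so it supplies \<open>t 0\<close>.\<close>
  moreover have "gauss_binomial w (2 * Suc m) (Suc (Suc m)) = 1"
    using gauss_binomial_n_add[of m] gauss_binomial_symmetric[of m "n + m" w] m
    by (simp add: mult_2)
  ultimately have "(\<Sum>k\<le>n-1. w ^ Suc k * gauss_binomial w (2 * k) (Suc k)) = (\<Sum>k\<le>m. t (Suc k)) + t 0"
    using m power_n by (simp add: t_def binomial_eq_0)
  also have "\<dots> = sum t {..Suc m}"
    by (simp only: sum.atMost_Suc_shift add.commute)
  \<comment> \<open>The added terms of index n and n + 1 have top at most 1 < n and vanish.\<close>
  also have "\<dots> = sum t {..n + 1}"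
    by (simp add: m t_def)
  finally show ?thesis by (simp add: alt_gauss_sum_def t_def)
qed

section \<open>Comparison of exponents\<close>

lemma eq_w_powerI: "x * p ^ i = 1 \<Longrightarrow> x = w ^ i"
  by (metis mult.assoc mult.commute mult.right_neutral w_p_power)

lemma p_power_mult_n_add: "p ^ (n * a + b) = p ^ b"
  by (simp add: power_add power_mult p_power_n)

text \<open>Sums of index 2 modulo 3 vanish, so the first sum drops out for n = 0 and the second for
  n = 1 modulo 3. For n = 2 modulo 3 both survive; the second equals 1, which gives the constant
  -1.\<close>

lemma alt_gauss_sum_eq:
  "alt_gauss_sum p (n - 1) - alt_gauss_sum p (n + 1) =
    (if n mod 3 = 0 \<or> n mod 3 = 1 then w ^ (n div 3) else - 1 - w ^ ((2 * n - 1) div 3))"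
proof -
  define r where "r = n div 6"
  let ?A = "alt_gauss_sum p (6 * r)"
  have power_mult_eqI: "p ^ a * p ^ b = p ^ c" if "a + b = c" for a b c
    by (simp only: power_add that[symmetric])
  \<comment> \<open>The closed form multiplied by a further p^i, with i chosen in each case to match
    the exponent needed.\<close>
  have A: "?A * p ^ j = p ^ k" if "r + i = j" "6 * r * r + i = k" for i j k
    using alt_gauss_sum_6_mult[of p r] unfolding that[symmetric] power_add
    by (simp flip: mult.assoc)
  have A1: "alt_gauss_sum p (6 * r + 1) = p ^ (6 * r * r + r)"
    by (rule alt_gauss_sum_6_mult_add_1)
  have A3: "alt_gauss_sum p (6 * r + 3) = - (p ^ (6 * r + 1) * ?A)"
    by (rule alt_gauss_sum_add_3)
  have A4: "alt_gauss_sum p (6 * r + 4) = - (p ^ (6 * r * r + 7 * r + 2))"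
    using alt_gauss_sum_add_3[of p "6 * r + 1"] unfolding A1
    by (simp add: algebra_simps flip: power_add)
  have A6: "alt_gauss_sum p (6 * r + 6) = p ^ (12 * r + 5) * ?A"
    using alt_gauss_sum_add_6[of p "6 * r"] by simp
  have A2: "alt_gauss_sum p (6 * r + 2) = 0"
    using alt_gauss_sum_3_mult_add_2[of p "2 * r"] by simp
  have A5: "alt_gauss_sum p (6 * r + 5) = 0"
    using alt_gauss_sum_3_mult_add_2[of p "2 * r + 1"] by (simp add: add.commute)
  have "n = 6 * r \<or> n = 6 * r + 1 \<or> n = 6 * r + 2 \<or> n = 6 * r + 3
      \<or> n = 6 * r + 4 \<or> n = 6 * r + 5"
    unfolding r_def by presburger
  then consider "n = 6 * r" | "n = 6 * r + 1" | "n = 6 * r + 2" | "n = 6 * r + 3"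
    | "n = 6 * r + 4" | "n = 6 * r + 5"
    by blast
  then show ?thesis
  proof cases
    case 1
    then have m: "n mod 3 = 0" "n div 3 = 2 * r" "n - 1 = 3 * (2 * r - 1) + 2"
      using n_ge_2 by auto
    have "p ^ (6 * r * r + r) * p ^ (2 * r) = p ^ (n * r + 3 * r)"
      by (intro power_mult_eqI) (simp add: 1 algebra_simps)
    moreover have half: "p ^ (3 * r) = -1" using 1 p_power_half[of "3 * r"] by simp
    ultimately have "- (p ^ (6 * r * r + r)) = w ^ (2 * r)"
      unfolding p_power_mult_n_add half by (intro eq_w_powerI) simp
    then show ?thesis
      by (simp only: m alt_gauss_sum_3_mult_add_2) (simp add: 1 A1[simplified])
  next
    case 2
    then have m: "n mod 3 = 1" "n div 3 = 2 * r" "n - 1 = 6 * r" "n + 1 = 6 * r + 2"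
      by presburger+
    have "?A * p ^ (2 * r) = p ^ (n * r + 0)"
      by (rule A[of r]) (simp_all add: 2 algebra_simps)
    then have "?A = w ^ (2 * r)"
      by (intro eq_w_powerI) (simp only: p_power_mult_n_add power_0)
    then show ?thesis by (simp only: m A2) simp
  next
    case 3
    then have m: "n mod 3 = 2" "(2 * n - 1) div 3 = 4 * r + 1" "n - 1 = 6 * r + 1" "n + 1 = 6 * r + 3"
      by presburger+
    have half: "p ^ (3 * r + 1) = -1" using 3 p_power_half[of "3 * r + 1"] by simp
    have "p ^ (6 * r * r + r) * p ^ (4 * r + 1) = p ^ (n * r + (3 * r + 1))"
      by (intro power_mult_eqI) (simp add: 3 algebra_simps)
    then have "- (p ^ (6 * r * r + r)) = w ^ (4 * r + 1)"
      unfolding p_power_mult_n_add half by (intro eq_w_powerI) simp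
    then have "p ^ (6 * r * r + r) = - (w ^ (4 * r + 1))"
      by (simp only: minus_equation_iff)
    moreover have "?A * p ^ (6 * r + 1) = p ^ (n * r + (3 * r + 1))"
      by (rule A[of "5 * r + 1"]) (simp_all add: 3 algebra_simps)
    then have "p ^ (6 * r + 1) * ?A = -1"
      unfolding p_power_mult_n_add half by (simp only: mult.commute)
    ultimately show ?thesis by (simp only: m A1 A3) simp
  next
    case 4
    then have m: "n mod 3 = 0" "n div 3 = 2 * r + 1" "n - 1 = 6 * r + 2" "n + 1 = 6 * r + 4"
      by presburger+
    have "p ^ (6 * r * r + 7 * r + 2) * p ^ (2 * r + 1) = p ^ (n * (r + 1) + 0)"
      by (intro power_mult_eqI) (simp add: 4 algebra_simps)
    then have "p ^ (6 * r * r + 7 * r + 2) = w ^ (2 * r + 1)"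
      by (intro eq_w_powerI) (simp only: p_power_mult_n_add power_0)
    then show ?thesis by (simp only: m A2 A4) simp
  next
    case 5
    then have m: "n mod 3 = 1" "n div 3 = 2 * r + 1" "n - 1 = 6 * r + 3" "n + 1 = 6 * r + 5"
      by presburger+
    have half: "p ^ (3 * r + 2) = -1" using 5 p_power_half[of "3 * r + 2"] by simp
    have "p ^ (6 * r + 1) * ?A * p ^ (2 * r + 1) = ?A * p ^ (8 * r + 2)"
      using power_mult_eqI[of "6 * r + 1" "2 * r + 1" "8 * r + 2"] by (simp only: mult_ac)
    also have "\<dots> = p ^ (n * r + (3 * r + 2))"
      by (rule A[of "7 * r + 2"]) (simp_all add: 5 algebra_simps)
    finally have "- (p ^ (6 * r + 1) * ?A) = w ^ (2 * r + 1)"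
      unfolding p_power_mult_n_add half by (intro eq_w_powerI) simp
    then show ?thesis by (simp only: m A3 A5) simp
  next
    case 6
    then have m: "n mod 3 = 2" "(2 * n - 1) div 3 = 4 * r + 3" "n - 1 = 6 * r + 4" "n + 1 = 6 * r + 6"
      by presburger+
    have "p ^ (6 * r * r + 7 * r + 2) * p ^ (4 * r + 3) = p ^ (n * (r + 1) + 0)"
      by (intro power_mult_eqI) (simp add: 6 algebra_simps)
    then have "p ^ (6 * r * r + 7 * r + 2) = w ^ (4 * r + 3)"
      by (intro eq_w_powerI) (simp only: p_power_mult_n_add power_0)
    moreover have "?A * p ^ (12 * r + 5) = p ^ (n * (r + 1) + 0)"
      by (rule A[of "11 * r + 5"]) (simp_all add: 6 algebra_simps)
    then have "p ^ (12 * r + 5) * ?A = 1"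
      by (simp only: p_power_mult_n_add power_0 mult.commute)
    ultimately show ?thesis by (simp only: m A4 A6) simp
  qed
qed

lemma sum_catalan:
  "(\<Sum>k\<le>n-1. w ^ k * (gauss_binomial w (2 * k) k - w * gauss_binomial w (2 * k) (Suc k))) =
    (if n mod 3 = 0 \<or> n mod 3 = 1 then w ^ (n div 3) else - 1 - w ^ ((2 * n - 1) div 3))"
proof -
  have "(\<Sum>k\<le>n-1. w ^ k * (gauss_binomial w (2 * k) k - w * gauss_binomial w (2 * k) (Suc k))) =
      alt_gauss_sum p (n - 1) - alt_gauss_sum p (n + 1)"
    unfolding sum_central[symmetric] sum_off_central[symmetric]
    by (simp add: sum_subtractf algebra_simps)
  then show ?thesis by (simp only: alt_gauss_sum_eq)
qed

end

section \<open>Divisibility by the cyclotomic polynomial\<close>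

lemma prod_linear_dvd:
  fixes P :: "'a::field poly"
  assumes "finite S" "inj_on f S" "\<And>m. m \<in> S \<Longrightarrow> poly P (f m) = 0"
  shows "(\<Prod>m\<in>S. [:- f m, 1:]) dvd P"
  using assms
proof (induction S arbitrary: P)
  case (insert m S)
  then obtain R where R: "P = [:- f m, 1:] * R"
    by (metis dvdE insertI1 poly_eq_0_iff_dvd)
  have "poly R (f l) = 0" if "l \<in> S" for l
  proof -
    have "f l \<noteq> f m" using insert.prems(1) insert.hyps that by (auto simp: inj_on_def)
    then show ?thesis using insert.prems(2)[of l] that unfolding R by simp
  qed
  then have "(\<Prod>m\<in>S. [:- f m, 1:]) dvd R"
    using insert.IH[of R] insert.prems(1) by simp
  then show ?case
    unfolding R prod.insert[OF insert.hyps] by (rule mult_dvd_mono[OF dvd_refl])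
qed simp

text \<open>Division by a monic polynomial stays over the integers. The remainder is a complex
  multiple of g of smaller degree, hence 0.\<close>

lemma monic_dvd_if_map_poly_of_int_dvd:
  assumes "lead_coeff g = 1" "(map_poly of_int g :: complex poly) dvd map_poly of_int P"
  shows "g dvd P"
proof -
  have g0: "g \<noteq> 0" using assms(1) by auto
  obtain s r where sr: "pseudo_divmod P g = (s, r)" by force
  from pseudo_divmod[OF g0 sr] assms(1)
  have P: "P = g * s + r" and r: "r = 0 \<or> degree r < degree g" by auto
  have "(map_poly of_int g :: complex poly) dvd map_poly of_int r"
    using assms(2) unfolding P map_poly_of_int_add map_poly_of_int_mult
    by (metis dvd_add_right_iff dvd_triv_left)
  then have "r = 0"
    using r dvd_imp_degree_le[of "map_poly of_int g :: complex poly" "map_poly of_int r"]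
      map_poly_of_int_inject[of r 0]
    by (auto simp: degree_map_poly_of_int)
  then show ?thesis by (simp add: P)
qed

lemma cyclotomic_dvdI:
  assumes "n > 0"
    and "\<And>w. w ^ n = 1 \<Longrightarrow> (\<And>i. 0 < i \<Longrightarrow> i < n \<Longrightarrow> w ^ i \<noteq> 1) \<Longrightarrow>
      poly (map_poly of_int P) (w :: complex) = 0"
  shows "cyclotomic n dvd P"
proof -
  define f :: "nat \<Rightarrow> complex" where "f m = exp (2 * of_real pi * \<i> * of_nat m / of_nat n)" for m
  have f_cis: "f = (\<lambda>m. cis (2 * pi * real m / real n))"
    by (auto simp: f_def cis_conv_exp mult_ac)
  have bij: "bij_betw f {..<n} {z. z ^ n = 1}"
    using bij_betw_roots_unity[OF assms(1)] by (simp add: f_cis)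
  have f_power: "f m = f 1 ^ m" for m
    by (simp add: f_cis DeMoivre mult_ac)
  have f_1: "f 1 ^ n = 1"
    using assms(1) by (simp add: f_cis DeMoivre)
  have inj: "inj_on f {..<n}" using bij by (rule bij_betw_imp_inj_on)
  have "poly (map_poly of_int P) (f m) = 0" if "m < n" "coprime m n" for m
  proof (rule assms(2))
    show "f m ^ n = 1" using bij that(1) by (auto simp: bij_betw_def)
    fix i assume i: "0 < i" "i < n"
    show "f m ^ i \<noteq> 1"
    proof
      assume "f m ^ i = 1"
      \<comment> \<open>Reducing i m modulo n lets injectivity of f on residues force n to divide i
        m, hence i.\<close>
      have "f m ^ i = f 1 ^ (n * (i * m div n) + i * m mod n)"
        by (simp add: f_power[of m] mult.commute flip: power_mult)
      also have "\<dots> = f (i * m mod n)"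
        by (simp only: power_add power_mult f_1 power_one mult_1 f_power[of "i * m mod n"])
      finally have "f (i * m mod n) = f 0" using \<open>f m ^ i = 1\<close> by (simp add: f_def)
      then have "i * m mod n = 0"
        using inj assms(1) by (simp add: inj_on_def)
      then have "n dvd i" using that(2) by (simp add: coprime_commute coprime_dvd_mult_left_iff mod_eq_0_iff_dvd)
      then show False using i by (auto dest: dvd_imp_le)
    qed
  qed
  moreover have "inj_on f {m. m < n \<and> coprime m n}"
    using inj by (rule inj_on_subset) auto
  ultimately have "complex_cyclotomic n dvd map_poly of_int P"
    unfolding complex_cyclotomic_def f_def[symmetric] by (intro prod_linear_dvd) auto
  moreover have "lead_coeff (cyclotomic n) = 1"
    using monic_complex_cyclotomic[of n] unfolding map_poly_cyclotomic[symmetric]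
    by (simp add: degree_map_poly_of_int coeff_map_poly)
  ultimately show ?thesis
    by (intro monic_dvd_if_map_poly_of_int_dvd) (simp_all add: map_poly_cyclotomic)
qed

section \<open>Evaluation of integer polynomials at a complex number\<close>

definition ev :: "complex \<Rightarrow> int poly \<Rightarrow> complex" where
  "ev w P = poly (map_poly of_int P) w"

lemma ev_add: "ev w (P + Q) = ev w P + ev w Q"
  and ev_mult: "ev w (P * Q) = ev w P * ev w Q"
  by (simp_all add: ev_def map_poly_of_int_add map_poly_of_int_mult)

lemma ev_0 [simp]: "ev w 0 = 0" and ev_1 [simp]: "ev w 1 = 1"
  by (simp_all add: ev_def)

lemma ev_uminus: "ev w (- P) = - ev w P"
  using ev_add[of w P "- P"] by (simp add: eq_neg_iff_add_eq_0 add.commute)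

lemma ev_diff: "ev w (P - Q) = ev w P - ev w Q"
  using ev_add[of w P "- Q"] by (simp add: ev_uminus)

lemma ev_sum: "ev w (sum f A) = (\<Sum>x\<in>A. ev w (f x))"
  by (induction A rule: infinite_finite_induct) (simp_all add: ev_add)

lemma ev_power: "ev w (P ^ k) = ev w P ^ k"
  by (induction k) (simp_all add: ev_mult)

lemma ev_qvar: "ev w qvar = w"
  by (simp add: ev_def map_poly_pCons)

lemmas ev_simps = ev_add ev_mult ev_uminus ev_diff ev_sum ev_power ev_qvar

lemma ev_gauss_binomial: "ev w (gauss_binomial q n k) = gauss_binomial (ev w q) n k"
  by (induction q n k rule: gauss_binomial.induct) (simp_all add: ev_simps)

theorem theorem6p1:
  fixes n :: nat
  assumes "n > 0"
  shows "cyclotomic n dvd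
    (\<Sum>k=0..n - 1. qvar ^ k * qcatalan k) -
    (if n mod 3 = 0 \<or> n mod 3 = 1 then qvar ^ (n div 3)
     else - 1 - qvar ^ ((2 * n - 1) div 3))"
proof (cases "n = 1")
  case True
  \<comment> \<open>For n = 1 both sides equal 1. This case is separate because the off-central sum
    needs p to differ from 1.\<close>
  have "qcatalan 0 = 1"
    by (simp add: qcatalan_eq_diff qbinomial_eq_gauss_binomial)
  then show ?thesis using True by simp
next
  case False
  show ?thesis
  proof (rule cyclotomic_dvdI[OF assms])
    fix w :: complex
    assume w: "w ^ n = 1" "\<And>i. 0 < i \<Longrightarrow> i < n \<Longrightarrow> w ^ i \<noteq> 1"
    interpret primitive_root w n
      using assms False w by unfold_locales auto
    have "ev w (\<Sum>k=0..n - 1. qvar ^ k * qcatalan k) =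
        (\<Sum>k\<le>n-1. w ^ k * (gauss_binomial w (2 * k) k - w * gauss_binomial w (2 * k) (Suc k)))"
      by (simp only: atLeast0AtMost qcatalan_eq_diff qbinomial_eq_gauss_binomial ev_simps
          ev_gauss_binomial Suc_eq_plus1)
    then have "ev w ((\<Sum>k=0..n - 1. qvar ^ k * qcatalan k) -
        (if n mod 3 = 0 \<or> n mod 3 = 1 then qvar ^ (n div 3)
         else - 1 - qvar ^ ((2 * n - 1) div 3))) = 0"
      by (simp only: sum_catalan ev_diff) (simp only: ev_simps ev_1 split: if_split, simp)
    then show "poly (map_poly of_int ((\<Sum>k=0..n - 1. qvar ^ k * qcatalan k) -
        (if n mod 3 = 0 \<or> n mod 3 = 1 then qvar ^ (n div 3)
         else - 1 - qvar ^ ((2 * n - 1) div 3)))) w = 0"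
      by (simp only: ev_def)
  qed
qed

end
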